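(* Let $J:\mathbb{R}^N\to\mathbb{R}$ be a finite-valued convex function, $\Phi\in\mathbb{R}^{Q\times N}$, $y\in\mathbb{R}^Q$, $\lambda>0$. Let $x\in\mathbb{R}^N$ and $f_x\in\operatorname{ri}\partial J(x)$. Put $T=T_x$, $S=T^\perp$ and assume $\operatorname{Ker}(\Phi)\cap T=\{0\}$. (i) If $$\Phi_T^*(y-\Phi x)=\lambda e_x\qquad\text{and}\qquad J_{f_x}^{x,\circ}\big(\lambda^{-1}\Phi_S^*(y-\Phi x)-P_S f_x\big)<1,$$ then $x$ is the unique solution of $\min_{z\in\mathbb{R}^N}\tfrac12\|y-\Phi z\|^2+\lambda J(z)$. (ii) If $\Phi x=y$ and there exists $\alpha\in\mathbb{R}^Q$ such that $$\Phi_T^*\alpha=e_x\qquad\text{and}\qquad J_{f_x}^{x,\circ}\big(\Phi_S^*\alpha-P_S f_x\big)<1,$$ then $x$ is the unique solution of $\min_{z\in\mathbb{R}^N}J(z)$ subject to $\Phi z=y$.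
   Context: For a finite-valued convex function $J$ on $\mathbb{R}^N$ and $x\in\mathbb{R}^N$: $\bar S_x$ is the affine hull of $\partial J(x)$; $e_x$ is the orthogonal projection of $0$ onto $\bar S_x$; $S_x=\bar S_x-e_x$ (a linear subspace) and $T_x=S_x^\perp$ (the model subspace). For a subspace $V$, $P_V$ is the orthogonal projector onto $V$, $\Phi_V=\Phi P_V$, and $\Phi_V^*$ is the adjoint of $\Phi_V$. $\operatorname{ri}$ is the relative interior. For a closed convex set $C\ni0$, its gauge is $\gamma_C(u)=\inf\{\lambda>0:u\in\lambda C\}$ (with $\inf\emptyset=+\infty$). The subdifferential gauge is $J_{f_x}^{x,\circ}=\gamma_{\partial J(x)-f_x}$. *)

theory Defs
  imports "HOL-Analysis.Analysis"
begin

definition subdifferential :: "('a::euclidean_space \<Rightarrow> real) \<Rightarrow> 'a \<Rightarrow> 'a set" where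
  "subdifferential J x = {v. \<forall>z. J z \<ge> J x + v \<bullet> (z - x)}"

text \<open>The orthogonal projection onto a nonempty closed convex set (in particular onto an affine
  hull or a linear subspace) is the library's nearest-point map \<open>closest_point\<close>.\<close>

definition model_vector :: "('a::euclidean_space \<Rightarrow> real) \<Rightarrow> 'a \<Rightarrow> 'a" where
  "model_vector J x = closest_point (affine hull subdifferential J x) 0"

definition model_direction_space :: "('a::euclidean_space \<Rightarrow> real) \<Rightarrow> 'a \<Rightarrow> 'a set" where
  "model_direction_space J x = (\<lambda>v. v - model_vector J x) ` (affine hull subdifferential J x)"

definition model_subspace :: "('a::euclidean_space \<Rightarrow> real) \<Rightarrow> 'a \<Rightarrow> 'a set" where
  "model_subspace J x = orthogonal_comp (model_direction_space J x)"

text \<open>The matrix \<open>\<Phi>\<close> restricted to \<open>V\<close> is regarded as the linear map \<open>\<Phi> P\<^sub>V\<close> on the whole space,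
  so its adjoint \<open>adjoint (restrict_map_to \<Phi> V)\<close> goes from the observation space back to
  the whole signal space.\<close>

definition restrict_map_to :: "real^'n^'q \<Rightarrow> (real^'n) set \<Rightarrow> real^'n \<Rightarrow> real^'q" where
  "restrict_map_to \<Phi> V = (\<lambda>u. \<Phi> *v closest_point V u)"

text \<open>The infimum is taken in the extended reals, where the infimum of the empty set
  is \<open>\<infinity>\<close>.\<close>

definition gauge_fun :: "'a::real_vector set \<Rightarrow> 'a \<Rightarrow> ereal" where
  "gauge_fun C u = Inf (ereal ` {l. 0 < l \<and> u \<in> (\<lambda>c. l *\<^sub>R c) ` C})"

definition subdifferential_gauge ::
    "('a::euclidean_space \<Rightarrow> real) \<Rightarrow> 'a \<Rightarrow> 'a \<Rightarrow> 'a \<Rightarrow> ereal" where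
  "subdifferential_gauge J x f = gauge_fun ((\<lambda>v. v - f) ` subdifferential J x)"

definition is_unique_solution :: "('a \<Rightarrow> real) \<Rightarrow> ('a \<Rightarrow> bool) \<Rightarrow> 'a \<Rightarrow> bool" where
  "is_unique_solution F P x \<longleftrightarrow> is_arg_min F P x \<and> (\<forall>z. is_arg_min F P z \<longrightarrow> z = x)"

end

theory Submission
  imports Defs
begin

text \<open>
  The dual vector \<open>g = \<Phi>\<^sup>* \<alpha>\<close> (with \<open>\<alpha> = \<lambda>\<^sup>-\<^sup>1 (y - \<Phi> x)\<close> in the penalized problem) is a
  certificate for \<open>x\<close>. Every subgradient at \<open>x\<close> has the same component \<open>e\<close> along \<open>T\<close>, namely the
  model vector; hence the two conditions on \<open>g\<close> say that \<open>g = f + l (c - f)\<close> for some subgradient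
  \<open>c\<close> and some \<open>l < 1\<close>. As \<open>f\<close> is a relative interior point of the subdifferential, so is \<open>g\<close>
  (lemma \<open>certificate_in_rel_interior\<close>).

  That \<open>g\<close> is a subgradient in the range of \<open>\<Phi>\<^sup>*\<close> makes \<open>x\<close> a solution. Uniqueness uses the
  relative interior: if \<open>z\<close> is another solution, then the subgradient inequality for \<open>g\<close> is an
  equality at \<open>z\<close>, so the linear functional \<open>w \<mapsto> w \<bullet> (z - x)\<close> attains its maximum over the
  subdifferential at the relative interior point \<open>g\<close>. It is therefore constant there, that is,
  \<open>z - x \<in> T\<close> (lemma \<open>subgradient_equality_imp_model_subspace\<close>). For both problems also
  \<open>\<Phi> (z - x) = 0\<close>: by the constraint in the second one, by strict convexity of the squared norm
  in the first. Injectivity of \<open>\<Phi>\<close> on \<open>T\<close> gives \<open>z = x\<close>.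
\<close>

lemma is_unique_solutionI:
  assumes "P x" and "\<And>z. P z \<Longrightarrow> F z \<le> F x \<Longrightarrow> z = x"
  shows "is_unique_solution F P x"
  unfolding is_unique_solution_def is_arg_min_def
proof (intro conjI allI impI notI)
  show "P x"
    by (fact assms(1))
next
  assume "\<exists>z. P z \<and> F z < F x"
  then show False
    using assms(2) by force
next
  fix z assume "P z \<and> (\<nexists>y. P y \<and> F y < F z)"
  then show "z = x"
    using assms by (intro assms(2)) (auto simp: not_less)
qed

section \<open>Projections and adjoints\<close>

text \<open>The variational inequality of the projection holds for \<open>a\<close> and for the reflection of \<open>a\<close>
  through the projected point, which an affine set also contains.\<close>

lemma closest_point_affine_orthogonal:
  fixes A :: "'a::euclidean_space set"
  assumes "affine A" "a \<in> A"
  shows "(u - closest_point A u) \<bullet> (a - closest_point A u) = 0"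
proof -
  let ?p = "closest_point A u"
  have cl: "closed A" and cv: "convex A"
    using assms by (auto simp: affine_closed affine_imp_convex)
  have p: "?p \<in> A"
    using closest_point_in_set[OF cl] assms by blast
  have "2 *\<^sub>R ?p + (-1) *\<^sub>R a \<in> A"
    using assms p by (intro mem_affine) auto
  from closest_point_dot[OF cv cl this, of u]
  have "(u - ?p) \<bullet> - (a - ?p) \<le> 0"
    by (simp add: scaleR_2)
  then have "0 \<le> (u - ?p) \<bullet> (a - ?p)"
    by (simp only: inner_minus_right neg_le_0_iff_le)
  with closest_point_dot[OF cv cl \<open>a \<in> A\<close>, of u] show ?thesis
    by simp
qed

lemma closest_point_in_subspace:
  fixes V :: "'a::euclidean_space set"
  assumes "subspace V"
  shows "closest_point V u \<in> V"
  using closest_point_in_set[OF closed_subspace[OF assms]] subspace_0[OF assms] by blast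

lemma closest_point_subspace_residual:
  fixes V :: "'a::euclidean_space set"
  assumes V: "subspace V"
  shows "u - closest_point V u \<in> orthogonal_comp V"
proof -
  have "v \<bullet> (u - closest_point V u) = 0" if "v \<in> V" for v
  proof -
    have "v + closest_point V u \<in> V"
      by (simp add: V that closest_point_in_subspace subspace_add)
    from closest_point_affine_orthogonal[OF subspace_imp_affine[OF V] this, of u]
    show ?thesis
      by (simp add: inner_commute)
  qed
  then show ?thesis
    by (simp add: orthogonal_comp_def orthogonal_def)
qed

lemma closest_point_subspace_eqI:
  fixes V :: "'a::euclidean_space set"
  assumes V: "subspace V" and p: "p \<in> V" and r: "u - p \<in> orthogonal_comp V"
  shows "closest_point V u = p"
proof -
  let ?d = "closest_point V u - p"
  have "?d \<in> V"
    by (simp add: V p closest_point_in_subspace subspace_diff)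
  moreover have "(u - p) - (u - closest_point V u) \<in> orthogonal_comp V"
    by (intro subspace_diff subspace_orthogonal_comp r closest_point_subspace_residual V)
  then have "?d \<in> orthogonal_comp V"
    by simp
  ultimately have "?d \<bullet> ?d = 0"
    by (auto simp: orthogonal_comp_def orthogonal_def)
  then show ?thesis
    by simp
qed

lemma closest_point_orthogonal_comp:
  fixes V :: "'a::euclidean_space set"
  assumes "subspace V"
  shows "closest_point (orthogonal_comp V) u = u - closest_point V u"
  by (rule closest_point_subspace_eqI)
    (use assms in \<open>auto simp: subspace_orthogonal_comp closest_point_subspace_residual
      orthogonal_comp_self closest_point_in_subspace\<close>)

lemma closest_point_subspace_scaleR:
  fixes V :: "'a::euclidean_space set"
  assumes V: "subspace V"
  shows "closest_point V (k *\<^sub>R u) = k *\<^sub>R closest_point V u"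
proof (rule closest_point_subspace_eqI[OF V])
  show "k *\<^sub>R closest_point V u \<in> V"
    by (intro subspace_scale V closest_point_in_subspace)
  have "k *\<^sub>R (u - closest_point V u) \<in> orthogonal_comp V"
    by (intro subspace_scale subspace_orthogonal_comp closest_point_subspace_residual V)
  then show "k *\<^sub>R u - k *\<^sub>R closest_point V u \<in> orthogonal_comp V"
    by (simp add: scaleR_diff_right)
qed

lemma closest_point_subspace_self_adjoint:
  fixes V :: "'a::euclidean_space set"
  assumes V: "subspace V"
  shows "closest_point V u \<bullet> w = u \<bullet> closest_point V w"
proof -
  have orth: "closest_point V a \<bullet> (b - closest_point V b) = 0" for a b
    using closest_point_subspace_residual[OF V, of b] closest_point_in_subspace[OF V, of a]
    by (auto simp: orthogonal_comp_def orthogonal_def)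
  from orth[of u w] orth[of w u] show ?thesis
    by (simp add: inner_diff_right inner_commute)
qed

lemma adjoint_restrict_map_to:
  assumes "subspace V"
  shows "adjoint (restrict_map_to \<Phi> V) a = closest_point V (a v* \<Phi>)"
proof -
  have "adjoint (restrict_map_to \<Phi> V) = (\<lambda>a. closest_point V (a v* \<Phi>))"
  proof (rule adjoint_unique, intro allI)
    fix u a
    have "restrict_map_to \<Phi> V u \<bullet> a = (a v* \<Phi>) \<bullet> closest_point V u"
      by (simp add: restrict_map_to_def dot_lmul_matrix inner_commute[of "\<Phi> *v _"])
    also have "\<dots> = u \<bullet> closest_point V (a v* \<Phi>)"
      by (metis closest_point_subspace_self_adjoint[OF assms] inner_commute)
    finally show "restrict_map_to \<Phi> V u \<bullet> a = u \<bullet> closest_point V (a v* \<Phi>)" .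
  qed
  then show ?thesis
    by simp
qed

section \<open>The subdifferential and the model subspace\<close>

lemma convex_subdifferential: "convex (subdifferential J x)"
proof (rule convexI)
  fix v w and a b :: real
  assume v: "v \<in> subdifferential J x" and w: "w \<in> subdifferential J x"
    and ab: "0 \<le> a" "0 \<le> b" "a + b = 1"
  have "(a *\<^sub>R v + b *\<^sub>R w) \<bullet> (z - x) \<le> J z - J x" for z
  proof -
    have "v \<bullet> (z - x) \<le> J z - J x" "w \<bullet> (z - x) \<le> J z - J x"
      using v w by (simp_all add: subdifferential_def algebra_simps)
    then have "a * (v \<bullet> (z - x)) + b * (w \<bullet> (z - x)) \<le> J z - J x"
      using ab by (intro convex_bound_le)
    then show ?thesis
      by (simp add: inner_add_left)
  qed
  then show "a *\<^sub>R v + b *\<^sub>R w \<in> subdifferential J x"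
    by (simp add: subdifferential_def algebra_simps)
qed

lemma model_vector_in_affine_hull:
  assumes "subdifferential J x \<noteq> {}"
  shows "model_vector J x \<in> affine hull subdifferential J x"
  unfolding model_vector_def
  using assms by (intro closest_point_in_set) auto

lemma subspace_model_direction_space:
  assumes "subdifferential J x \<noteq> {}"
  shows "subspace (model_direction_space J x)"
  unfolding model_direction_space_def
  by (rule affine_diffs_subspace_subtract) (auto simp: model_vector_in_affine_hull assms)

lemma model_vector_in_model_subspace: "model_vector J x \<in> model_subspace J x"
proof -
  have "(v - model_vector J x) \<bullet> model_vector J x = 0"
    if "v \<in> affine hull subdifferential J x" for v
    using closest_point_affine_orthogonal[OF affine_affine_hull that, of 0]
    by (simp add: model_vector_def inner_commute)
  then show ?thesis
    by (auto simp: model_subspace_def model_direction_space_def orthogonal_comp_def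
        orthogonal_def)
qed

text \<open>All subgradients have the same projection \<open>model_vector J x\<close> onto the model subspace, so
  a subgradient is determined by its projection onto the direction space.\<close>

lemma closest_point_model_direction_space:
  assumes "f \<in> subdifferential J x"
  shows "closest_point (model_direction_space J x) f = f - model_vector J x"
proof (rule closest_point_subspace_eqI)
  show "subspace (model_direction_space J x)"
    using assms by (intro subspace_model_direction_space) auto
  show "f - model_vector J x \<in> model_direction_space J x"
    using assms by (auto simp: model_direction_space_def hull_inc)
  show "f - (f - model_vector J x) \<in> orthogonal_comp (model_direction_space J x)"
    using model_vector_in_model_subspace[of J x] by (simp add: model_subspace_def)
qed

text \<open>A direction on which all subgradients agree is orthogonal to the affine hull of the
  subdifferential, because a hyperplane is affine.\<close>

lemma in_model_subspace_if_inner_const: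
  assumes ne: "subdifferential J x \<noteq> {}"
    and const: "\<And>w. w \<in> subdifferential J x \<Longrightarrow> h \<bullet> w = b"
  shows "h \<in> model_subspace J x"
proof -
  have "affine hull subdifferential J x \<subseteq> {w. h \<bullet> w = b}"
    by (rule hull_minimal) (auto simp: const affine_hyperplane)
  then have "h \<bullet> v = h \<bullet> model_vector J x" if "v \<in> affine hull subdifferential J x" for v
    using that model_vector_in_affine_hull[OF ne] by auto
  then have "(v - model_vector J x) \<bullet> h = 0" if "v \<in> affine hull subdifferential J x" for v
    using that by (simp add: inner_diff_right inner_commute[of "v - model_vector J x"])
  then show ?thesis
    by (auto simp: model_subspace_def model_direction_space_def orthogonal_comp_def
        orthogonal_def)
qed

section \<open>Dual certificates\<close>

lemma gauge_fun_less_1D: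
  assumes "gauge_fun C u < 1"
  obtains l c where "0 < l" "l < 1" "c \<in> C" "u = l *\<^sub>R c"
  using assms by (auto simp: gauge_fun_def Inf_less_iff one_ereal_def)

text \<open>A subdifferential gauge below \<open>1\<close> puts \<open>g\<close> on a segment from \<open>f\<close> to a subgradient \<open>c\<close>,
  before its end \<open>c\<close>; such points inherit membership in the relative interior from \<open>f\<close>.\<close>

lemma certificate_in_rel_interior:
  fixes J :: "'a::euclidean_space \<Rightarrow> real"
  assumes f: "f \<in> rel_interior (subdifferential J x)"
    and T: "T = model_subspace J x" and S: "S = orthogonal_comp T"
    and gT: "closest_point T g = model_vector J x"
    and gS: "subdifferential_gauge J x f (closest_point S g - closest_point S f) < 1"
  shows "g \<in> rel_interior (subdifferential J x)"
proof -
  have fD: "f \<in> subdifferential J x"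
    using f rel_interior_subset by blast
  then have "subspace (model_direction_space J x)"
    by (intro subspace_model_direction_space) auto
  then have S_eq: "S = model_direction_space J x"
    by (simp add: S T model_subspace_def orthogonal_comp_self)
  have "subspace T"
    by (simp add: T model_subspace_def subspace_orthogonal_comp)
  then have "closest_point S g = g - model_vector J x"
    by (simp add: S closest_point_orthogonal_comp gT)
  then have "closest_point S g - closest_point S f = g - f"
    by (simp add: S_eq closest_point_model_direction_space[OF fD])
  with gS obtain l c where l: "0 < l" "l < 1" and c: "c \<in> subdifferential J x"
    and g: "g - f = l *\<^sub>R (c - f)"
    unfolding subdifferential_gauge_def by (auto elim!: gauge_fun_less_1D)
  have "c - (1 - l) *\<^sub>R (c - f) \<in> rel_interior (subdifferential J x)"
    using l by (intro rel_interior_convex_shrink convex_subdifferential f c) auto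
  also have "c - (1 - l) *\<^sub>R (c - f) = f + (g - f)"
    unfolding g by (simp add: algebra_simps)
  finally show ?thesis
    by simp
qed

text \<open>Equality in the subgradient inequality makes \<open>g\<close> a maximizer of \<open>w \<mapsto> w \<bullet> (z - x)\<close> over
  the subdifferential. A segment from any \<open>w\<close> to the relative interior point \<open>g\<close> can be prolonged
  beyond \<open>g\<close>, where the functional would be larger if it were smaller at \<open>w\<close>.\<close>

lemma subgradient_equality_imp_model_subspace:
  fixes J :: "'a::euclidean_space \<Rightarrow> real"
  assumes g: "g \<in> rel_interior (subdifferential J x)"
    and eq: "J z \<le> J x + g \<bullet> (z - x)"
  shows "z - x \<in> model_subspace J x"
proof (rule in_model_subspace_if_inner_const)
  show "subdifferential J x \<noteq> {}"
    using g rel_interior_subset by blast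
  have max: "(z - x) \<bullet> w \<le> (z - x) \<bullet> g" if "w \<in> subdifferential J x" for w
  proof -
    have "J x + w \<bullet> (z - x) \<le> J z"
      using that by (simp add: subdifferential_def)
    then show ?thesis
      using eq by (simp add: inner_commute)
  qed
  fix w assume w: "w \<in> subdifferential J x"
  then obtain m where m: "m > 1" "(1 - m) *\<^sub>R w + m *\<^sub>R g \<in> subdifferential J x"
    using convex_rel_interior_if2[OF convex_subdifferential g] hull_inc
    by metis
  from max[OF m(2)] have "(m - 1) * ((z - x) \<bullet> g) \<le> (m - 1) * ((z - x) \<bullet> w)"
    by (simp add: algebra_simps)
  with m(1) have "(z - x) \<bullet> g \<le> (z - x) \<bullet> w"
    by simp
  with max[OF w] show "(z - x) \<bullet> w = (z - x) \<bullet> g"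
    by simp
qed

lemma certificate_imp_eq:
  assumes g: "g \<in> rel_interior (subdifferential J x)"
    and inj: "{u. \<Phi> *v u = 0} \<inter> model_subspace J x = {0}"
    and le: "J z \<le> J x + g \<bullet> (z - x)"
    and ker: "\<Phi> *v (z - x) = 0"
  shows "z = x"
proof -
  have "z - x \<in> {u. \<Phi> *v u = 0} \<inter> model_subspace J x"
    using subgradient_equality_imp_model_subspace[OF g le] ker by blast
  then show ?thesis
    unfolding inj by simp
qed

lemma constrained_unique_solution:
  fixes \<Phi> :: "real^'n^'q"
  assumes g: "\<alpha> v* \<Phi> \<in> rel_interior (subdifferential J x)"
    and inj: "{u. \<Phi> *v u = 0} \<inter> model_subspace J x = {0}"
    and feasible: "\<Phi> *v x = y"
  shows "is_unique_solution J (\<lambda>z. \<Phi> *v z = y) x"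
proof (rule is_unique_solutionI)
  show "\<Phi> *v x = y"
    by (fact feasible)
  fix z assume z: "\<Phi> *v z = y" "J z \<le> J x"
  then have ker: "\<Phi> *v (z - x) = 0"
    by (simp add: matrix_vector_mult_diff_distrib feasible)
  with z show "z = x"
    by (intro certificate_imp_eq[OF g inj _ ker]) (simp add: dot_lmul_matrix)
qed

text \<open>Expanding the square, the objective at \<open>z\<close> exceeds that at \<open>x\<close> by
  \<open>1 / 2 * (norm (\<Phi> (z - x)))\<^sup>2\<close> plus \<open>lam\<close> times the gap in the subgradient inequality of the
  certificate. Both are nonnegative, so at another minimizer both vanish.\<close>

lemma penalized_unique_solution:
  fixes \<Phi> :: "real^'n^'q"
  assumes lam: "lam > 0"
    and g: "inverse lam *\<^sub>R ((y - \<Phi> *v x) v* \<Phi>) \<in> rel_interior (subdifferential J x)"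
    and inj: "{u. \<Phi> *v u = 0} \<inter> model_subspace J x = {0}"
  shows "is_unique_solution (\<lambda>z. 1 / 2 * (norm (y - \<Phi> *v z))\<^sup>2 + lam * J z) (\<lambda>z. True) x"
proof (rule is_unique_solutionI, rule TrueI)
  fix z
  let ?g = "inverse lam *\<^sub>R ((y - \<Phi> *v x) v* \<Phi>)"
  define r where "r = y - \<Phi> *v x"
  define k where "k = \<Phi> *v (z - x)"
  define gap where "gap = J z - J x - ?g \<bullet> (z - x)"
  assume "1 / 2 * (norm (y - \<Phi> *v z))\<^sup>2 + lam * J z
    \<le> 1 / 2 * (norm (y - \<Phi> *v x))\<^sup>2 + lam * J x"
  moreover have "y - \<Phi> *v z = r - k"
    by (simp add: r_def k_def matrix_vector_mult_diff_distrib)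
  then have "(norm (y - \<Phi> *v z))\<^sup>2 = (norm r)\<^sup>2 - 2 * (r \<bullet> k) + (norm k)\<^sup>2"
    by (simp add: power2_norm_eq_inner inner_diff_left inner_diff_right inner_commute)
  moreover have "?g \<bullet> (z - x) = inverse lam * (r \<bullet> k)"
    by (simp add: dot_lmul_matrix r_def k_def)
  then have "lam * gap = lam * J z - lam * J x - r \<bullet> k"
    using lam by (simp add: gap_def right_diff_distrib)
  ultimately have sum: "1 / 2 * (norm k)\<^sup>2 + lam * gap \<le> 0"
    by (simp add: r_def algebra_simps)
  have "?g \<in> subdifferential J x"
    using g rel_interior_subset by blast
  then have "J x + ?g \<bullet> (z - x) \<le> J z"
    unfolding subdifferential_def by blast
  then have "gap \<ge> 0"
    by (simp add: gap_def)
  then have "lam * gap \<ge> 0"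
    using lam by simp
  with sum have "(norm k)\<^sup>2 \<le> 0" and "lam * gap \<le> 0"
    using zero_le_power2[of "norm k"] by linarith+
  with lam have k: "k = 0" and "gap \<le> 0"
    by (auto simp: mult_le_0_iff)
  then have "J z \<le> J x + ?g \<bullet> (z - x)"
    by (simp add: gap_def)
  then show "z = x"
    by (rule certificate_imp_eq[OF g inj]) (use k in \<open>simp add: k_def\<close>)
qed

section \<open>Identifiability of the solution\<close>

theorem theorem3:
  fixes J :: "real^'n \<Rightarrow> real"
    and \<Phi> :: "real^'n^'q"
    and y :: "real^'q"
    and lam :: real
    and x f :: "real^'n"
    and T S :: "(real^'n) set"
  assumes "convex_on UNIV J"
    and "lam > 0"
    and "f \<in> rel_interior (subdifferential J x)"
    and "T = model_subspace J x"
    and "S = orthogonal_comp T"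
    and "{u. \<Phi> *v u = 0} \<inter> T = {0}"
  shows
    "(adjoint (restrict_map_to \<Phi> T) (y - \<Phi> *v x) = lam *\<^sub>R model_vector J x \<and>
      subdifferential_gauge J x f
        (inverse lam *\<^sub>R adjoint (restrict_map_to \<Phi> S) (y - \<Phi> *v x) - closest_point S f) < 1
      \<longrightarrow> is_unique_solution (\<lambda>z. 1 / 2 * (norm (y - \<Phi> *v z))\<^sup>2 + lam * J z) (\<lambda>z. True) x)
     \<and>
     (\<Phi> *v x = y \<and>
      (\<exists>\<alpha> :: real^'q.
        adjoint (restrict_map_to \<Phi> T) \<alpha> = model_vector J x \<and>
        subdifferential_gauge J x f
          (adjoint (restrict_map_to \<Phi> S) \<alpha> - closest_point S f) < 1)
      \<longrightarrow> is_unique_solution J (\<lambda>z. \<Phi> *v z = y) x)"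
proof -
  note f = assms(3) and T = assms(4) and S = assms(5)
  have inj: "{u. \<Phi> *v u = 0} \<inter> model_subspace J x = {0}"
    using assms(6) T by simp
  have subT: "subspace T" and subS: "subspace S"
    by (simp_all add: T S model_subspace_def subspace_orthogonal_comp)
  note cert = certificate_in_rel_interior[OF f T S]
  note adj = adjoint_restrict_map_to[OF subT] adjoint_restrict_map_to[OF subS]
  note scale = closest_point_subspace_scaleR[OF subT] closest_point_subspace_scaleR[OF subS]
  show ?thesis
  proof (intro conjI impI; elim conjE exE)
    assume "adjoint (restrict_map_to \<Phi> T) (y - \<Phi> *v x) = lam *\<^sub>R model_vector J x"
      and "subdifferential_gauge J x f
        (inverse lam *\<^sub>R adjoint (restrict_map_to \<Phi> S) (y - \<Phi> *v x) - closest_point S f) < 1"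
    then have "inverse lam *\<^sub>R ((y - \<Phi> *v x) v* \<Phi>) \<in> rel_interior (subdifferential J x)"
      using \<open>lam > 0\<close> by (intro cert) (simp_all add: adj scale)
    then show "is_unique_solution (\<lambda>z. 1 / 2 * (norm (y - \<Phi> *v z))\<^sup>2 + lam * J z) (\<lambda>z. True) x"
      by (rule penalized_unique_solution[OF \<open>lam > 0\<close> _ inj])
  next
    fix \<alpha> :: "real^'q"
    assume feasible: "\<Phi> *v x = y"
      and "adjoint (restrict_map_to \<Phi> T) \<alpha> = model_vector J x"
      and "subdifferential_gauge J x f
        (adjoint (restrict_map_to \<Phi> S) \<alpha> - closest_point S f) < 1"
    then have "\<alpha> v* \<Phi> \<in> rel_interior (subdifferential J x)"
      by (intro cert) (simp_all add: adj)
    then show "is_unique_solution J (\<lambda>z. \<Phi> *v z = y) x"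
      by (rule constrained_unique_solution[OF _ inj feasible])
  qed
qed

end
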